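(* Let $n\ge1$ and let $\alpha\in(0,1)$ satisfy $$\mu=\frac{\alpha}{1-\alpha}\in(0,1),\qquad \beta=\frac{\alpha-\sigma}{1+\frac{\alpha}{\sqrt{2n}}}>0,\qquad\text{where }\sigma=\frac{\alpha^2}{2(1-\alpha)}$$ (i.e., $\alpha\in(0,0.5)$). (1) Let $\tau>0$, $z\in\mathbb{R}^n$, $x,s\in\mathbb{R}^{2n}$ satisfy $$(x,s)>0,\qquad \xi:=\frac{\|x\odot s-\tau e\|}{\tau}\le\alpha .$$ Let $(\Delta z,\Delta x,\Delta s)$ be the Newton direction at $(z,x,s)$ with parameter $\tau$ (defined in the context), and set $$(z^+,x^+,s^+)=(z,x,s)+(\Delta z,\Delta x,\Delta s),\qquad \tau^+=\Big(1-\frac{\beta}{\sqrt{2n}}\Big)\tau .$$ Then $$(x^+,s^+)\ge0,\qquad \xi^+:=\frac{\|x^+\odot s^+-\tau^+e\|}{\tau^+}\le\alpha .$$ (2) Furthermore, let $0<\epsilon<2n+\alpha\sqrt{2n}$. If the update $(z,x,s,\tau)\mapsto(z^+,x^+,s^+,\tau^+)$ is iterated starting from the initial point $(z^0,x^0,s^0)$ described in the context and $\tau^0=1$, then after exactly $$\mathcal{N}_{\mathrm{iter}}=\left\lceil\frac{\log\left(\frac{2n+\alpha\sqrt{2n}}{\epsilon}\right)}{-\log\left(1-\frac{\beta}{\sqrt{2n}}\right)}\right\rceil$$ iterations the inequality $x^\top s\le\epsilon$ holds.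
   Context: Conventions: $\odot$, and quotients and reciprocals of vectors, are componentwise; inequalities between vectors are componentwise; $e$ is the all-ones vector of appropriate dimension; $\|\cdot\|$ is the Euclidean norm; $\mathrm{col}(a,b)=[a^\top,b^\top]^\top$. Setting: $H=H^\top\in\mathbb{R}^{n\times n}$ is positive semidefinite, $h\in\mathbb{R}^n$, $h\neq0$; these are the data of the box-constrained QP $\min_{z\in\mathbb{R}^n}\frac12 z^\top Hz+z^\top h$ s.t. $-e\le z\le e$. Put $\lambda=\frac{\alpha}{\sqrt{2n}}$, $\tilde H=\frac{1}{\|h\|_\infty}H$, $\tilde h=\frac{1}{\|h\|_\infty}h$. Write $x=\mathrm{col}(\gamma,\theta)$, $s=\mathrm{col}(\phi,\psi)$ with $\gamma,\theta,\phi,\psi\in\mathbb{R}^n$, and correspondingly $\Delta x=\mathrm{col}(\Delta\gamma,\Delta\theta)$, $\Delta s=\mathrm{col}(\Delta\phi,\Delta\psi)$. Newton direction: $\Delta z$ is the solution of $$\Big(2\lambda\tilde H+\mathrm{diag}\Big(\frac{\gamma}{\phi}\Big)+\mathrm{diag}\Big(\frac{\theta}{\psi}\Big)\Big)\Delta z=\tau\frac1\psi-\tau\frac1\phi+\gamma-\theta,$$ and $\Delta\gamma=\frac{\gamma}{\phi}\odot\Delta z+\tau\frac1\phi-\gamma$, $\Delta\theta=-\frac{\theta}{\psi}\odot\Delta z+\tau\frac1\psi-\theta$, $\Delta\phi=-\Delta z$, $\Delta\psi=\Delta z$. Equivalently, with $\Omega=[I,-I]\in\mathbb{R}^{n\times2n}$,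 $(\Delta z,\Delta x,\Delta s)$ solves $2\lambda\tilde H\Delta z+\Omega\Delta x=0$, $\Omega^\top\Delta z+\Delta s=0$, $s\odot\Delta x+x\odot\Delta s=\tau e-x\odot s$. Initial point: $z^0=0$, $x^0=\mathrm{col}(\gamma^0,\theta^0)$, $s^0=\mathrm{col}(\phi^0,\psi^0)$ with $\gamma^0=e-\lambda\tilde h$, $\theta^0=e+\lambda\tilde h$, $\phi^0=\psi^0=e$. *)

theory Defs
  imports "HOL-Analysis.Analysis"
begin

text \<open>On \<^typ>\<open>real ^ 'n\<close> the library operations \<open>*\<close> and \<open>\<le>\<close> are componentwise and \<open>1\<close> is the
  all-ones vector. The library's \<open><\<close> on vectors is \<open>x \<le> y \<and> x \<noteq> y\<close>, so strict componentwise
  positivity needs its own predicate. Vectors of length \<open>2n\<close> are indexed by the sum type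
  \<^typ>\<open>'n + 'n\<close>.\<close>

definition vpos :: "real ^ 'm \<Rightarrow> bool" where
  "vpos v \<longleftrightarrow> (\<forall>i. 0 < v $ i)"

definition vdiv :: "real ^ 'm \<Rightarrow> real ^ 'm \<Rightarrow> real ^ 'm" where
  "vdiv u v = (\<chi> i. u $ i / v $ i)"

definition diag :: "real ^ 'm \<Rightarrow> real ^ 'm ^ 'm" where
  "diag v = (\<chi> i j. if i = j then v $ i else 0)"

definition col :: "real ^ 'n \<Rightarrow> real ^ 'n \<Rightarrow> real ^ ('n + 'n)" where
  "col a b = (\<chi> i. case i of Inl j \<Rightarrow> a $ j | Inr j \<Rightarrow> b $ j)"

definition upper :: "real ^ ('n + 'n) \<Rightarrow> real ^ 'n" where
  "upper x = (\<chi> j. x $ Inl j)"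

definition lower :: "real ^ ('n + 'n) \<Rightarrow> real ^ 'n" where
  "lower x = (\<chi> j. x $ Inr j)"

definition psd :: "real ^ 'n ^ 'n \<Rightarrow> bool" where
  "psd H \<longleftrightarrow> transpose H = H \<and> (\<forall>v. 0 \<le> v \<bullet> (H *v v))"

text \<open>The parameters \<open>lam\<close> and \<open>Ht\<close> are \<open>\<lambda>\<close> and the scaled matrix \<open>H / \<parallel>h\<parallel>\<^sub>\<infinity>\<close>.
  For positive semidefinite \<open>Ht\<close>, \<open>lam \<ge> 0\<close> and componentwise positive \<open>x\<close>, \<open>s\<close> the system
  is positive definite, so the description below denotes its unique solution.\<close>

definition newton_dz ::
    "real \<Rightarrow> real ^ 'n ^ 'n \<Rightarrow> real \<Rightarrow> real ^ ('n + 'n) \<Rightarrow> real ^ ('n + 'n) \<Rightarrow> real ^ 'n" where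
  "newton_dz lam Ht \<tau> x s =
    (let \<gamma> = upper x; \<theta> = lower x; \<phi> = upper s; \<psi> = lower s in
     THE dz. ((2 * lam) *\<^sub>R Ht + diag (vdiv \<gamma> \<phi>) + diag (vdiv \<theta> \<psi>)) *v dz
             = \<tau> *\<^sub>R vdiv 1 \<psi> - \<tau> *\<^sub>R vdiv 1 \<phi> + \<gamma> - \<theta>)"

definition newton_direction ::
    "real \<Rightarrow> real ^ 'n ^ 'n \<Rightarrow> real \<Rightarrow> real ^ ('n + 'n) \<Rightarrow> real ^ ('n + 'n)
      \<Rightarrow> (real ^ 'n) \<times> (real ^ ('n + 'n)) \<times> (real ^ ('n + 'n))" where
  "newton_direction lam Ht \<tau> x s =
    (let \<gamma> = upper x; \<theta> = lower x; \<phi> = upper s; \<psi> = lower s;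
         dz = newton_dz lam Ht \<tau> x s;
         d\<gamma> = vdiv \<gamma> \<phi> * dz + \<tau> *\<^sub>R vdiv 1 \<phi> - \<gamma>;
         d\<theta> = - (vdiv \<theta> \<psi> * dz) + \<tau> *\<^sub>R vdiv 1 \<psi> - \<theta>;
         d\<phi> = - dz;
         d\<psi> = dz
     in (dz, col d\<gamma> d\<theta>, col d\<phi> d\<psi>))"

type_synonym 'n state =
  "(real ^ 'n) \<times> (real ^ ('n + 'n)) \<times> (real ^ ('n + 'n)) \<times> real"

definition newton_update ::
    "real \<Rightarrow> real ^ 'n ^ 'n \<Rightarrow> real \<Rightarrow> 'n state \<Rightarrow> 'n state" where
  "newton_update lam Ht \<beta> = (\<lambda>(z, x, s, \<tau>).
    let (dz, dx, ds) = newton_direction lam Ht \<tau> x s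
    in (z + dz, x + dx, s + ds, (1 - \<beta> / sqrt (2 * real CARD('n))) * \<tau>))"

definition initial_state :: "real \<Rightarrow> real ^ 'n \<Rightarrow> 'n state" where
  "initial_state lam ht = (0, col (1 - lam *\<^sub>R ht) (1 + lam *\<^sub>R ht), col 1 1, 1)"

definition xi :: "real ^ 'm \<Rightarrow> real ^ 'm \<Rightarrow> real \<Rightarrow> real" where
  "xi x s \<tau> = norm (x * s - \<tau> *\<^sub>R 1) / \<tau>"

end

theory Submission
  imports Defs
begin

text \<open>The Newton direction satisfies the linearised complementarity equation
  \<open>s * dx + x * ds = \<tau> *\<^sub>R 1 - x * s\<close>, so after a full step all that separates \<open>x * s\<close> from
  \<open>\<tau> *\<^sub>R 1\<close> is the second-order term: \<open>(x + dx) * (s + ds) = \<tau> *\<^sub>R 1 + dx * ds\<close>. Two facts make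
  this term small. Eliminating the dual step from the Newton system gives
  \<open>dx \<bullet> ds = 2 \<lambda> (dz \<bullet> Ht *v dz) \<ge> 0\<close>, which is where positive semidefiniteness enters. Rescaling
  \<open>dx\<close> and \<open>ds\<close> by \<open>sqrt (s / x)\<close> and \<open>sqrt (x / s)\<close> does not change their product, and it turns
  the linearised equation into \<open>p + q = (\<tau> - x * s) / sqrt (x * s)\<close>. Since \<open>p \<bullet> q \<ge> 0\<close>, both factors
  are controlled by their sum, and \<open>x * s \<ge> (1 - \<alpha>) \<tau>\<close> near the central path yields
  \<open>norm (dx * ds) \<le> \<sigma> \<tau>\<close> (\<open>norm_newton_product_le\<close>).

  Replacing \<open>\<tau>\<close> by \<open>(1 - \<beta> / sqrt N) \<tau>\<close> with \<open>N = 2 n\<close> moves the target by a vector of norm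
  \<open>\<beta> \<tau>\<close>. The value of \<open>\<beta>\<close> is the one for which
  \<open>\<beta> + \<sigma> = \<alpha> (1 - \<beta> / sqrt N)\<close>, so the step lands in the same neighbourhood for the new parameter
  (\<open>newton_update_invariant\<close>). Positivity also persists, so the invariant can be iterated. The initial
  point lies in the neighbourhood because \<open>\<lambda>\<close> is scaled to give \<open>norm (x * s - 1) \<le> \<alpha>\<close>; and inside
  it the gap is at most \<open>(N + \<alpha> sqrt N) \<tau>\<close>, while \<open>\<tau>\<close> decays geometrically. The iteration count
  is the first exponent at which this bound falls to \<open>\<epsilon>\<close>.\<close>

section \<open>Componentwise products\<close>

lemma norm_vec_sq: "(norm (v :: real ^ 'm))\<^sup>2 = (\<Sum>i\<in>UNIV. (v $ i)\<^sup>2)"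
  unfolding power2_norm_eq_inner inner_vec_def by (simp add: power2_eq_square)

lemma norm_times_vec_le: "norm (p * q) \<le> norm p * norm (q :: real ^ 'm)"
proof -
  have "(norm (p * q))\<^sup>2 = (\<Sum>i\<in>UNIV. (p $ i)\<^sup>2 * (q $ i)\<^sup>2)"
    by (simp add: norm_vec_sq power_mult_distrib)
  also have "\<dots> \<le> (\<Sum>i\<in>UNIV. (norm p)\<^sup>2 * (q $ i)\<^sup>2)"
    by (intro sum_mono mult_right_mono)
       (auto simp: abs_le_square_iff[symmetric] component_le_norm_cart)
  also have "\<dots> = (norm p * norm q)\<^sup>2"
    by (simp add: norm_vec_sq[of q] sum_distrib_left power_mult_distrib)
  finally show ?thesis
    by (rule power2_le_imp_le) simp
qed

text \<open>Dropping the nonnegative cross term from \<open>(norm (p + q))\<^sup>2\<close> bounds the sum of the two squared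
  norms, and hence their product by the arithmetic-geometric mean inequality.\<close>

lemma norm_times_vec_le_norm_add:
  fixes p q :: "real ^ 'm"
  assumes "0 \<le> p \<bullet> q"
  shows "norm (p * q) \<le> (norm (p + q))\<^sup>2 / 2"
proof -
  have "(norm (p + q))\<^sup>2 = (norm p)\<^sup>2 + (norm q)\<^sup>2 + 2 * (p \<bullet> q)"
    by (simp add: power2_norm_eq_inner inner_simps inner_commute)
  moreover have "2 * (norm p * norm q) \<le> (norm p)\<^sup>2 + (norm q)\<^sup>2"
    using sum_squares_bound[of "norm p" "norm q"] by (simp add: mult.assoc)
  ultimately show ?thesis
    using norm_times_vec_le[of p q] assms by linarith
qed

lemma norm_one_vec: "norm (1 :: real ^ 'm) = sqrt (real CARD('m))"
  by (simp add: norm_eq_sqrt_inner inner_vec_def)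

section \<open>Neighbourhood of the central path\<close>

lemma xi_le_iff: "0 < \<tau> \<Longrightarrow> xi x s \<tau> \<le> \<alpha> \<longleftrightarrow> norm (x * s - \<tau> *\<^sub>R 1) \<le> \<alpha> * \<tau>"
  by (simp add: xi_def divide_le_eq)

lemma central_component_ge:
  assumes "0 < \<tau>" "xi x s \<tau> \<le> \<alpha>"
  shows "(1 - \<alpha>) * \<tau> \<le> x $ i * s $ i"
proof -
  have "\<bar>(x * s - \<tau> *\<^sub>R 1) $ i\<bar> \<le> \<alpha> * \<tau>"
    using assms component_le_norm_cart order_trans by (simp only: xi_le_iff) blast
  then show ?thesis
    by (simp add: algebra_simps)
qed

text \<open>The gap is the inner product of \<open>x * s\<close> with the all-ones vector, so Cauchy-Schwarz applies to
  its deviation from \<open>\<tau> *\<^sub>R 1\<close>.\<close>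

lemma central_inner_le:
  fixes x s :: "real ^ 'm"
  assumes "0 < \<tau>" "xi x s \<tau> \<le> \<alpha>"
  shows "x \<bullet> s \<le> (real CARD('m) + \<alpha> * sqrt (real CARD('m))) * \<tau>"
proof -
  have "x \<bullet> s = (x * s - \<tau> *\<^sub>R 1) \<bullet> 1 + real CARD('m) * \<tau>"
    by (simp add: inner_vec_def sum_subtractf)
  also have "(x * s - \<tau> *\<^sub>R 1) \<bullet> 1 \<le> norm (x * s - \<tau> *\<^sub>R 1) * sqrt (real CARD('m))"
    using norm_cauchy_schwarz[of "x * s - \<tau> *\<^sub>R 1" 1] by (simp only: norm_one_vec)
  also have "\<dots> \<le> \<alpha> * \<tau> * sqrt (real CARD('m))"
    using assms by (intro mult_right_mono) (simp_all add: xi_le_iff)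
  finally show ?thesis
    by (simp add: algebra_simps)
qed

text \<open>The factors \<open>sqrt (s / x)\<close> and \<open>sqrt (x / s)\<close> are mutually inverse, so scaling the two steps
  by them leaves both their componentwise and their inner product unchanged. The scaled steps add up
  to a multiple of the residual, because
  \<open>sqrt (s / x) dx + sqrt (x / s) ds = (s dx + x ds) / sqrt (x s)\<close>.\<close>

lemma norm_newton_product_le:
  fixes x s dx ds :: "real ^ 'm"
  assumes \<tau>: "0 < \<tau>" and x: "vpos x" and s: "vpos s" and xi: "xi x s \<tau> \<le> \<alpha>" and \<alpha>: "\<alpha> < 1"
    and lin: "s * dx + x * ds = \<tau> *\<^sub>R 1 - x * s" and inner: "0 \<le> dx \<bullet> ds"
  shows "norm (dx * ds) \<le> \<alpha>\<^sup>2 / (2 * (1 - \<alpha>)) * \<tau>"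
proof -
  define w :: "real ^ 'm" where "w = (\<chi> i. sqrt (s $ i / x $ i))"
  define p where "p = w * dx"
  define q where "q = vdiv ds w"
  have xi_pos: "0 < x $ i" and si_pos: "0 < s $ i" for i
    using x s by (simp_all add: vpos_def)
  have w_pos: "0 < w $ i" for i
    using xi_pos[of i] si_pos[of i] by (simp add: w_def)
  have pq: "p $ i * q $ i = dx $ i * ds $ i" for i
    using w_pos[of i] by (simp add: p_def q_def vdiv_def)
  have "p * q = dx * ds"
    by (simp add: vec_eq_iff pq)
  moreover have "p \<bullet> q = dx \<bullet> ds"
    by (simp add: inner_vec_def pq)
  ultimately have "norm (dx * ds) \<le> (norm (p + q))\<^sup>2 / 2"
    using norm_times_vec_le_norm_add[of p q] inner by simp
  also have "(norm (p + q))\<^sup>2 \<le> (norm (x * s - \<tau> *\<^sub>R 1))\<^sup>2 / ((1 - \<alpha>) * \<tau>)"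
  proof -
    have "((p + q) $ i)\<^sup>2 \<le> ((x * s - \<tau> *\<^sub>R 1) $ i)\<^sup>2 / ((1 - \<alpha>) * \<tau>)" for i
    proof -
      have lin_i: "s $ i * dx $ i + x $ i * ds $ i = \<tau> - x $ i * s $ i"
        using arg_cong[OF lin, of "\<lambda>v. v $ i"] by simp
      have w2: "x $ i * (w $ i)\<^sup>2 = s $ i"
        using xi_pos[of i] si_pos[of i] by (simp add: w_def)
      have "x $ i * w $ i * (p + q) $ i = (x $ i * (w $ i)\<^sup>2) * dx $ i + x $ i * ds $ i"
        using w_pos[of i] by (simp add: p_def q_def vdiv_def field_simps power2_eq_square)
      also have "\<dots> = \<tau> - x $ i * s $ i"
        by (simp only: w2 lin_i)
      finally have "(x $ i * w $ i * (p + q) $ i)\<^sup>2 = ((x * s - \<tau> *\<^sub>R 1) $ i)\<^sup>2"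
        by (simp add: power2_commute)
      moreover have "(x $ i * w $ i * (p + q) $ i)\<^sup>2 = x $ i * (x $ i * (w $ i)\<^sup>2) * ((p + q) $ i)\<^sup>2"
        by (simp add: power_mult_distrib power2_eq_square)
      ultimately have eq: "x $ i * s $ i * ((p + q) $ i)\<^sup>2 = ((x * s - \<tau> *\<^sub>R 1) $ i)\<^sup>2"
        by (simp only: w2)
      have "(1 - \<alpha>) * \<tau> * ((p + q) $ i)\<^sup>2 \<le> x $ i * s $ i * ((p + q) $ i)\<^sup>2"
        by (intro mult_right_mono central_component_ge[OF \<tau> xi]) simp
      then show ?thesis
        using \<tau> \<alpha> by (simp only: eq) (simp add: pos_le_divide_eq mult.commute)
    qed
    then show ?thesis
      by (simp only: norm_vec_sq sum_divide_distrib) (rule sum_mono)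
  qed
  also have "(norm (x * s - \<tau> *\<^sub>R 1))\<^sup>2 / ((1 - \<alpha>) * \<tau>) \<le> (\<alpha> * \<tau>)\<^sup>2 / ((1 - \<alpha>) * \<tau>)"
    using xi \<tau> \<alpha> by (intro divide_right_mono power_mono) (simp_all add: xi_le_iff)
  also have "(\<alpha> * \<tau>)\<^sup>2 / ((1 - \<alpha>) * \<tau>) / 2 = \<alpha>\<^sup>2 / (2 * (1 - \<alpha>)) * \<tau>"
    using \<tau> \<alpha> by (simp add: power2_eq_square field_simps)
  finally show ?thesis
    by simp
qed

lemma newton_step_product:
  fixes x s dx ds :: "real ^ 'm"
  assumes lin: "s * dx + x * ds = \<tau> *\<^sub>R 1 - x * s"
  shows "(x + dx) * (s + ds) = \<tau> *\<^sub>R 1 + dx * ds"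
proof -
  have "(x + dx) * (s + ds) = x * s + (s * dx + x * ds) + dx * ds"
    by (simp add: algebra_simps)
  also have "\<dots> = \<tau> *\<^sub>R 1 + dx * ds"
    by (simp only: lin) simp
  finally show ?thesis .
qed

text \<open>The componentwise products after the step are positive, so the new \<open>x\<close> and \<open>s\<close> agree in sign
  in every component. They cannot both be negative: that would make \<open>s dx + x ds\<close> smaller than
  \<open>- 2 x s\<close>, whereas it equals \<open>\<tau> - x s\<close>.\<close>

lemma newton_step_positive:
  fixes x s dx ds :: "real ^ 'm"
  assumes \<tau>: "0 < \<tau>" and x: "vpos x" and s: "vpos s"
    and lin: "s * dx + x * ds = \<tau> *\<^sub>R 1 - x * s" and small: "norm (dx * ds) < \<tau>"
  shows "vpos (x + dx)" "vpos (s + ds)"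
proof -
  have "0 < (x + dx) $ i \<and> 0 < (s + ds) $ i" for i
  proof -
    have xi_pos: "0 < x $ i" and si_pos: "0 < s $ i"
      using x s by (simp_all add: vpos_def)
    have "\<bar>(dx * ds) $ i\<bar> < \<tau>"
      using component_le_norm_cart small by (rule le_less_trans)
    moreover have "(x $ i + dx $ i) * (s $ i + ds $ i) = \<tau> + dx $ i * ds $ i"
      using arg_cong[OF newton_step_product[OF lin], of "\<lambda>v. v $ i"] by simp
    ultimately have "0 < (x $ i + dx $ i) * (s $ i + ds $ i)"
      by simp
    moreover have "\<not> (x $ i + dx $ i < 0 \<and> s $ i + ds $ i < 0)"
    proof
      assume neg: "x $ i + dx $ i < 0 \<and> s $ i + ds $ i < 0"
      have "s $ i * (x $ i + dx $ i) + x $ i * (s $ i + ds $ i) < 0"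
        using neg xi_pos si_pos by (simp add: add_neg_neg mult_pos_neg)
      moreover have "s $ i * dx $ i + x $ i * ds $ i = \<tau> - x $ i * s $ i"
        using arg_cong[OF lin, of "\<lambda>v. v $ i"] by simp
      moreover have "0 < x $ i * s $ i"
        using xi_pos si_pos by simp
      ultimately show False
        using \<tau> by (simp add: algebra_simps)
    qed
    ultimately show ?thesis
      by (auto simp: zero_less_mult_iff)
  qed
  then show "vpos (x + dx)" "vpos (s + ds)"
    by (simp_all add: vpos_def)
qed

text \<open>Lowering the target from \<open>\<tau>\<close> to \<open>(1 - \<beta> / sqrt N) \<tau>\<close> costs \<open>\<beta> / sqrt N \<cdot> \<tau> \<cdot> norm 1 = \<beta> \<tau>\<close>.
  With the bound \<open>\<sigma> \<tau>\<close> on the second-order term the triangle inequality closes exactly when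
  \<open>\<beta> + \<sigma> \<le> \<alpha> (1 - \<beta> / sqrt N)\<close>.\<close>

lemma newton_step_central:
  fixes x s dx ds :: "real ^ 'm"
  assumes \<tau>: "0 < \<tau>" and lin: "s * dx + x * ds = \<tau> *\<^sub>R 1 - x * s"
    and small: "norm (dx * ds) \<le> \<sigma> * \<tau>"
    and \<beta>: "0 \<le> \<beta>" and rho_pos: "0 < 1 - \<beta> / sqrt (real CARD('m))"
    and le: "\<beta> + \<sigma> \<le> \<alpha> * (1 - \<beta> / sqrt (real CARD('m)))"
  shows "xi (x + dx) (s + ds) ((1 - \<beta> / sqrt (real CARD('m))) * \<tau>) \<le> \<alpha>"
proof -
  let ?N = "real CARD('m)"
  have "(x + dx) * (s + ds) - ((1 - \<beta> / sqrt ?N) * \<tau>) *\<^sub>R 1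
      = (\<beta> / sqrt ?N * \<tau>) *\<^sub>R 1 + dx * ds"
    unfolding newton_step_product[OF lin] by (simp add: algebra_simps)
  also have "norm \<dots> \<le> norm ((\<beta> / sqrt ?N * \<tau>) *\<^sub>R (1 :: real ^ 'm)) + norm (dx * ds)"
    by (rule norm_triangle_ineq)
  also have "norm ((\<beta> / sqrt ?N * \<tau>) *\<^sub>R (1 :: real ^ 'm)) = \<beta> * \<tau>"
    using \<beta> \<tau> by (simp add: norm_one_vec abs_mult)
  also have "\<beta> * \<tau> + norm (dx * ds) \<le> (\<beta> + \<sigma>) * \<tau>"
    using small by (simp add: distrib_right)
  also have "\<dots> \<le> \<alpha> * (1 - \<beta> / sqrt ?N) * \<tau>"
    using le \<tau> by (intro mult_right_mono) auto
  finally show ?thesis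
    using rho_pos \<tau> by (simp add: xi_le_iff mult.assoc)
qed

section \<open>The Newton system\<close>

lemma positive_definite_solve:
  fixes A :: "real ^ 'n ^ 'n"
  assumes "\<And>v. v \<noteq> 0 \<Longrightarrow> 0 < v \<bullet> (A *v v)"
  shows "\<exists>!v. A *v v = b"
proof -
  have "inj ((*v) A)"
  proof (rule injI)
    fix u v assume "A *v u = A *v v"
    then have "(u - v) \<bullet> (A *v (u - v)) = 0"
      by (simp add: matrix_vector_mult_diff_distrib)
    then show "u = v"
      using assms[of "u - v"] by fastforce
  qed
  moreover from this have "surj ((*v) A)"
    by (simp add: linear_injective_imp_surjective)
  ultimately show ?thesis
    by (metis injD surjD)
qed

lemma diag_mult_vec: "diag d *v v = d * v"
  by (simp add: vec_eq_iff diag_def matrix_vector_mult_def if_distrib if_distribR cong: if_cong)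

lemma newton_matrix_positive_definite:
  fixes Ht :: "real ^ 'n ^ 'n"
  assumes "psd Ht" "0 \<le> lam" "vpos d" "vpos e" "v \<noteq> 0"
  shows "0 < v \<bullet> (((2 * lam) *\<^sub>R Ht + diag d + diag e) *v v)"
proof -
  have pos: "0 < v \<bullet> (d * v)" if "vpos d" for d
  proof -
    obtain i where "v $ i \<noteq> 0"
      using \<open>v \<noteq> 0\<close> by (auto simp: vec_eq_iff)
    then have "0 < v $ i * (d $ i * v $ i)"
      using that by (simp add: vpos_def mult.left_commute[of "v $ i"] mult_pos_pos
          power2_eq_square[symmetric])
    moreover have "0 \<le> v $ j * (d $ j * v $ j)" for j
      using that by (simp add: vpos_def mult.left_commute[of "v $ j"] less_imp_le
          power2_eq_square[symmetric])
    ultimately show ?thesis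
      unfolding inner_vec_def by (auto intro!: sum_pos2)
  qed
  have "0 \<le> lam * (v \<bullet> (Ht *v v))"
    using assms by (simp add: psd_def)
  then show ?thesis
    using pos[OF \<open>vpos d\<close>] pos[OF \<open>vpos e\<close>]
    by (simp add: matrix_vector_mult_add_rdistrib diag_mult_vec inner_add_right
        scaleR_matrix_vector_assoc[symmetric])
qed

lemma newton_dz_solves:
  fixes Ht :: "real ^ 'n ^ 'n"
  assumes "psd Ht" "0 \<le> lam" "vpos x" "vpos s"
  shows "(2 * lam) *\<^sub>R (Ht *v newton_dz lam Ht \<tau> x s)
      + vdiv (upper x) (upper s) * newton_dz lam Ht \<tau> x s
      + vdiv (lower x) (lower s) * newton_dz lam Ht \<tau> x s
    = \<tau> *\<^sub>R vdiv 1 (lower s) - \<tau> *\<^sub>R vdiv 1 (upper s) + upper x - lower x"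
proof -
  let ?A = "(2 * lam) *\<^sub>R Ht + diag (vdiv (upper x) (upper s)) + diag (vdiv (lower x) (lower s))"
  let ?b = "\<tau> *\<^sub>R vdiv 1 (lower s) - \<tau> *\<^sub>R vdiv 1 (upper s) + upper x - lower x"
  have "vpos (vdiv (upper x) (upper s))" "vpos (vdiv (lower x) (lower s))"
    using assms by (simp_all add: vpos_def vdiv_def upper_def lower_def)
  then have "\<exists>!v. ?A *v v = ?b"
    using assms by (intro positive_definite_solve newton_matrix_positive_definite)
  then have "?A *v newton_dz lam Ht \<tau> x s = ?b"
    unfolding newton_dz_def Let_def by (rule theI')
  then show ?thesis
    by (simp add: matrix_vector_mult_add_rdistrib diag_mult_vec
        scaleR_matrix_vector_assoc[symmetric])
qed

lemma inner_col: "col a b \<bullet> col c d = a \<bullet> c + b \<bullet> d"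
  unfolding inner_vec_def UNIV_Plus_UNIV[symmetric]
  by (simp add: col_def sum.Plus del: UNIV_Plus_UNIV)

text \<open>The step formulas are the linearised complementarity equations solved for \<open>dx\<close>, so those hold
  whatever \<open>dz\<close> is. The equation for \<open>dz\<close> expresses the difference of the two halves of \<open>dx\<close> as
  \<open>- 2 \<lambda> Ht dz\<close>, and \<open>dx \<bullet> ds\<close> is minus the inner product of this difference with \<open>dz\<close>.\<close>

lemma newton_direction_properties:
  fixes Ht :: "real ^ 'n ^ 'n"
  assumes psd: "psd Ht" and lam: "0 \<le> lam" and x: "vpos x" and s: "vpos s"
    and dir: "newton_direction lam Ht \<tau> x s = (dz, dx, ds)"
  shows "s * dx + x * ds = \<tau> *\<^sub>R 1 - x * s" and "0 \<le> dx \<bullet> ds"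
proof -
  define d\<gamma> where "d\<gamma> = vdiv (upper x) (upper s) * dz + \<tau> *\<^sub>R vdiv 1 (upper s) - upper x"
  define d\<theta> where "d\<theta> = - (vdiv (lower x) (lower s) * dz) + \<tau> *\<^sub>R vdiv 1 (lower s) - lower x"
  have dz: "dz = newton_dz lam Ht \<tau> x s" and dx: "dx = col d\<gamma> d\<theta>" and ds: "ds = col (- dz) dz"
    using dir by (auto simp: newton_direction_def Let_def d\<gamma>_def d\<theta>_def)
  have s_nz: "s $ i \<noteq> 0" for i
    using s by (metis vpos_def less_irrefl)
  show "s * dx + x * ds = \<tau> *\<^sub>R 1 - x * s"
  proof (simp only: vec_eq_iff, rule allI)
    fix i
    show "(s * dx + x * ds) $ i = (\<tau> *\<^sub>R 1 - x * s) $ i"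
      using s_nz[of i]
      by (cases i) (simp_all add: dx ds d\<gamma>_def d\<theta>_def col_def vdiv_def upper_def lower_def field_simps)
  qed
  have "d\<theta> - d\<gamma> = (2 * lam) *\<^sub>R (Ht *v dz)"
    using newton_dz_solves[OF psd lam x s, of \<tau>]
    unfolding dz[symmetric] d\<gamma>_def d\<theta>_def by (simp add: algebra_simps)
  moreover have "dx \<bullet> ds = (d\<theta> - d\<gamma>) \<bullet> dz"
    by (simp add: dx ds inner_col inner_diff_left)
  ultimately show "0 \<le> dx \<bullet> ds"
    using psd lam by (simp add: psd_def inner_commute)
qed

section \<open>Invariance and convergence\<close>

lemma card_sum_self: "real CARD('n::finite + 'n) = 2 * real CARD('n)"
  by simp

text \<open>The conclusion gives strict positivity, since this is what makes the Newton system of the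
  following step positive definite and the step repeatable.\<close>

lemma newton_update_invariant:
  fixes Ht :: "real ^ 'n ^ 'n"
  defines "N \<equiv> 2 * real CARD('n)"
  assumes psd: "psd Ht" and lam: "0 \<le> lam" and \<alpha>: "\<alpha> < 1" and \<sigma>: "\<alpha>\<^sup>2 / (2 * (1 - \<alpha>)) < 1"
    and \<beta>: "0 \<le> \<beta>" and rho_pos: "0 < 1 - \<beta> / sqrt N"
    and le: "\<beta> + \<alpha>\<^sup>2 / (2 * (1 - \<alpha>)) \<le> \<alpha> * (1 - \<beta> / sqrt N)"
    and \<tau>: "0 < \<tau>" and x: "vpos x" and s: "vpos s" and xi: "xi x s \<tau> \<le> \<alpha>"
    and upd: "newton_update lam Ht \<beta> (z, x, s, \<tau>) = (z', x', s', \<tau>')"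
  shows "\<tau>' = (1 - \<beta> / sqrt N) * \<tau>" "vpos x'" "vpos s'" "xi x' s' \<tau>' \<le> \<alpha>"
proof -
  obtain dz dx ds where dir: "newton_direction lam Ht \<tau> x s = (dz, dx, ds)"
    by (metis prod.exhaust)
  note lin = newton_direction_properties(1)[OF psd lam x s dir]
  have new: "x' = x + dx" "s' = s + ds"
    and \<tau>': "\<tau>' = (1 - \<beta> / sqrt N) * \<tau>"
    using upd by (simp_all add: newton_update_def dir N_def)
  have small: "norm (dx * ds) \<le> \<alpha>\<^sup>2 / (2 * (1 - \<alpha>)) * \<tau>"
    by (rule norm_newton_product_le[OF \<tau> x s xi \<alpha> lin newton_direction_properties(2)[OF psd lam x s dir]])
  also have "\<dots> < 1 * \<tau>"
    using \<sigma> \<tau> by (rule mult_strict_right_mono)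
  finally have "norm (dx * ds) < \<tau>"
    by simp
  then show "vpos x'" "vpos s'"
    unfolding new by (rule newton_step_positive[OF \<tau> x s lin])+
  show "\<tau>' = (1 - \<beta> / sqrt N) * \<tau>"
    by (rule \<tau>')
  show "xi x' s' \<tau>' \<le> \<alpha>"
    using newton_step_central[OF \<tau> lin small \<beta>] rho_pos le
    unfolding new \<tau>' N_def card_sum_self by blast
qed

text \<open>Since \<open>s = 1\<close>, the deviation \<open>x * s - 1\<close> consists of two copies of \<open>\<lambda> ht\<close> up to sign, of norm
  \<open>sqrt 2 \<lambda> norm ht \<le> \<lambda> sqrt (2 n)\<close>. A deviation below \<open>1\<close> also keeps every component positive.\<close>

lemma initial_state_central:
  fixes ht :: "real ^ 'n"
  assumes lam: "0 \<le> lam" and bound: "lam * sqrt (2 * real CARD('n)) \<le> \<alpha>"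
    and \<alpha>: "\<alpha> < 1" and ht: "infnorm ht \<le> 1"
    and init: "initial_state lam ht = (z, x, s, \<tau>)"
  shows "\<tau> = 1" "vpos x" "vpos s" "xi x s \<tau> \<le> \<alpha>"
proof -
  have x: "x = col (1 - lam *\<^sub>R ht) (1 + lam *\<^sub>R ht)" and s: "s = col 1 1" and \<tau>: "\<tau> = 1"
    using init by (simp_all add: initial_state_def)
  have s_nth: "s $ i = 1" for i
    by (cases i) (simp_all add: s col_def)
  have dev: "x * s - \<tau> *\<^sub>R 1 = col (- (lam *\<^sub>R ht)) (lam *\<^sub>R ht)"
  proof (simp only: vec_eq_iff, rule allI)
    fix i
    show "(x * s - \<tau> *\<^sub>R 1) $ i = col (- (lam *\<^sub>R ht)) (lam *\<^sub>R ht) $ i"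
      by (cases i) (simp_all add: s_nth x \<tau> col_def)
  qed
  have "norm ht \<le> sqrt (real CARD('n)) * infnorm ht"
    using norm_le_infnorm[of ht] by simp
  also have "\<dots> \<le> sqrt (real CARD('n)) * 1"
    using ht by (intro mult_left_mono) auto
  finally have ht': "norm ht \<le> sqrt (real CARD('n))"
    by simp
  have "(norm (x * s - \<tau> *\<^sub>R 1))\<^sup>2 = 2 * (lam * norm ht)\<^sup>2"
    unfolding dev power2_norm_eq_inner inner_col
    by (simp add: dot_square_norm power_mult_distrib power2_eq_square)
  also have "\<dots> \<le> 2 * (lam * sqrt (real CARD('n)))\<^sup>2"
    using ht' lam by (intro mult_left_mono power_mono) auto
  also have "\<dots> = (lam * sqrt (2 * real CARD('n)))\<^sup>2"
    by (simp add: power_mult_distrib)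
  finally have "norm (x * s - \<tau> *\<^sub>R 1) \<le> lam * sqrt (2 * real CARD('n))"
    by (rule power2_le_imp_le) (simp add: lam)
  then show xi: "xi x s \<tau> \<le> \<alpha>"
    using bound by (simp add: xi_le_iff \<tau>)
  show "\<tau> = 1"
    by (rule \<tau>)
  have "0 < x $ i" for i
    using central_component_ge[of \<tau> x s \<alpha> i] xi \<alpha> by (simp add: \<tau> s_nth)
  then show "vpos x"
    by (simp add: vpos_def)
  show "vpos s"
    by (simp add: vpos_def s_nth)
qed

lemma power_nat_ceiling_log_le:
  fixes q C \<epsilon> :: real
  assumes q: "0 < q" "q < 1" and "0 < \<epsilon>" "0 < C"
  shows "q ^ nat \<lceil>ln (C / \<epsilon>) / (- ln q)\<rceil> * C \<le> \<epsilon>"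
proof -
  let ?k = "nat \<lceil>ln (C / \<epsilon>) / (- ln q)\<rceil>"
  have "ln (C / \<epsilon>) / (- ln q) \<le> real ?k"
    by (rule real_nat_ceiling_ge)
  moreover have "0 < - ln q"
    using q by simp
  ultimately have "ln (C / \<epsilon>) \<le> real ?k * (- ln q)"
    by (simp only: pos_divide_le_eq)
  then have "ln (q ^ ?k * C) \<le> ln \<epsilon>"
    using assms by (simp add: ln_div ln_mult ln_realpow)
  then show ?thesis
    using assms by (subst (asm) ln_le_cancel_iff) auto
qed

theorem corollary1:
  fixes H Ht :: "real ^ 'n ^ 'n" and h ht :: "real ^ 'n"
    and \<alpha> \<mu> \<sigma> \<beta> lam n :: real
  assumes "psd H" and "h \<noteq> 0"
    and n_def: "n = real CARD('n)"
    and lam_def: "lam = \<alpha> / sqrt (2 * n)"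
    and Ht_def: "Ht = (1 / infnorm h) *\<^sub>R H"
    and ht_def: "ht = (1 / infnorm h) *\<^sub>R h"
    and "0 < \<alpha>" and "\<alpha> < 1"
    and mu_def: "\<mu> = \<alpha> / (1 - \<alpha>)"
    and "0 < \<mu>" and "\<mu> < 1"
    and sigma_def: "\<sigma> = \<alpha>\<^sup>2 / (2 * (1 - \<alpha>))"
    and beta_def: "\<beta> = (\<alpha> - \<sigma>) / (1 + \<alpha> / sqrt (2 * n))"
    and "0 < \<beta>"
  shows
    "(\<forall>z x s \<tau> z' x' s' \<tau>'.
        0 < \<tau> \<and> vpos x \<and> vpos s \<and> xi x s \<tau> \<le> \<alpha> \<and>
        newton_update lam Ht \<beta> (z, x, s, \<tau>) = (z', x', s', \<tau>')
        \<longrightarrow> 0 \<le> x' \<and> 0 \<le> s' \<and> xi x' s' \<tau>' \<le> \<alpha>)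
     \<and>
     (\<forall>\<epsilon> z x s \<tau>.
        0 < \<epsilon> \<and> \<epsilon> < 2 * n + \<alpha> * sqrt (2 * n) \<and>
        (newton_update lam Ht \<beta> ^^
           nat \<lceil>ln ((2 * n + \<alpha> * sqrt (2 * n)) / \<epsilon>) / (- ln (1 - \<beta> / sqrt (2 * n)))\<rceil>)
          (initial_state lam ht) = (z, x, s, \<tau>)
        \<longrightarrow> x \<bullet> s \<le> \<epsilon>)"
proof -
  define N where "N = 2 * n"
  define q where "q = 1 - \<beta> / sqrt N"
  have N: "N = 2 * real CARD('n)" and n_nonneg: "0 \<le> n"
    by (simp_all add: N_def n_def)
  have "1 \<le> real CARD('n)"
    by (simp add: Suc_leI)
  then have "1 < N"
    unfolding N by linarith
  then have sqrt_N: "1 < sqrt N"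
    by simp
  have lam: "0 \<le> lam"
    using \<open>0 < \<alpha>\<close> n_nonneg by (simp add: lam_def)
  have h_pos: "0 < infnorm h"
    using \<open>h \<noteq> 0\<close> by (simp add: infnorm_pos_lt)
  have psd: "psd Ht"
    using \<open>psd H\<close> h_pos
    by (simp add: psd_def Ht_def transpose_scalar scaleR_matrix_vector_assoc[symmetric])
  have denom: "1 < 1 + \<alpha> / sqrt N"
    using \<open>0 < \<alpha>\<close> sqrt_N by simp
  \<comment> \<open>This identity is the choice of \<open>\<beta>\<close>: it makes the inequality \<open>balance\<close> tight.\<close>
  have \<beta>_eq: "\<beta> * (1 + \<alpha> / sqrt N) = \<alpha> - \<sigma>"
    using denom by (simp add: beta_def N_def)
  then have balance: "\<beta> + \<alpha>\<^sup>2 / (2 * (1 - \<alpha>)) \<le> \<alpha> * (1 - \<beta> / sqrt N)"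
    by (simp add: sigma_def algebra_simps)
  have "\<beta> * 1 < \<beta> * (1 + \<alpha> / sqrt N)"
    using denom \<open>0 < \<beta>\<close> by (intro mult_strict_left_mono) auto
  then have "\<beta> < \<alpha> - \<sigma>"
    by (simp add: \<beta>_eq)
  moreover have "0 \<le> \<sigma>"
    using \<open>\<alpha> < 1\<close> by (simp add: sigma_def)
  ultimately have "\<beta> < 1" and "\<sigma> < 1"
    using \<open>\<alpha> < 1\<close> \<open>0 < \<beta>\<close> by linarith+
  then have \<sigma>: "\<alpha>\<^sup>2 / (2 * (1 - \<alpha>)) < 1"
    by (simp only: sigma_def)
  have "\<beta> < sqrt N"
    using \<open>\<beta> < 1\<close> sqrt_N by linarith
  then have q: "0 < q" "q < 1"
    using sqrt_N \<open>0 < \<beta>\<close> by (simp_all add: q_def)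
  note inv = newton_update_invariant[OF psd lam \<open>\<alpha> < 1\<close> \<sigma> less_imp_le[OF \<open>0 < \<beta>\<close>],
      folded N, folded q_def, OF q(1) balance[folded q_def]]

  have step: "0 \<le> x' \<and> 0 \<le> s' \<and> xi x' s' \<tau>' \<le> \<alpha>"
    if "0 < \<tau> \<and> vpos x \<and> vpos s \<and> xi x s \<tau> \<le> \<alpha> \<and>
        newton_update lam Ht \<beta> (z, x, s, \<tau>) = (z', x', s', \<tau>')" for z x s \<tau> z' x' s' \<tau>'
    using inv(2-4)[of \<tau> x s z z' x' s' \<tau>'] that
    by (simp add: vpos_def less_eq_vec_def less_imp_le)

  have iter: "\<tau> = q ^ k \<and> vpos x \<and> vpos s \<and> xi x s \<tau> \<le> \<alpha>"
    if "(newton_update lam Ht \<beta> ^^ k) (initial_state lam ht) = (z, x, s, \<tau>)" for k z x s \<tau>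
    using that
  proof (induction k arbitrary: z x s \<tau>)
    case 0
    have "lam * sqrt (2 * real CARD('n)) \<le> \<alpha>"
      using sqrt_N by (simp add: lam_def n_def N_def)
    moreover have "infnorm ht \<le> 1"
      using h_pos by (simp add: ht_def infnorm_mul)
    ultimately show ?case
      using initial_state_central[OF lam _ \<open>\<alpha> < 1\<close>, of ht z x s \<tau>] 0 by simp
  next
    case (Suc k)
    obtain z1 x1 s1 \<tau>1
      where prev: "(newton_update lam Ht \<beta> ^^ k) (initial_state lam ht) = (z1, x1, s1, \<tau>1)"
      by (metis prod.exhaust)
    have \<tau>1: "\<tau>1 = q ^ k" and IH: "vpos x1" "vpos s1" "xi x1 s1 \<tau>1 \<le> \<alpha>"
      using Suc.IH[OF prev] by blast+
    have upd: "newton_update lam Ht \<beta> (z1, x1, s1, \<tau>1) = (z, x, s, \<tau>)"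
      using Suc.prems prev by simp
    have "0 < \<tau>1"
      using \<tau>1 q by simp
    from inv[OF this IH upd] show ?case
      by (simp add: \<tau>1)
  qed

  have gap: "x \<bullet> s \<le> \<epsilon>"
    if eps: "0 < \<epsilon>" and run: "(newton_update lam Ht \<beta> ^^
           nat \<lceil>ln ((N + \<alpha> * sqrt N) / \<epsilon>) / (- ln (1 - \<beta> / sqrt N))\<rceil>)
          (initial_state lam ht) = (z, x, s, \<tau>)" for \<epsilon> z x s \<tau>
  proof -
    let ?k = "nat \<lceil>ln ((N + \<alpha> * sqrt N) / \<epsilon>) / (- ln q)\<rceil>"
    have \<tau>: "\<tau> = q ^ ?k" and xi: "xi x s \<tau> \<le> \<alpha>"
      using iter[OF run[folded q_def]] by blast+
    have "0 < \<tau>"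
      using \<tau> q by simp
    then have "x \<bullet> s \<le> (N + \<alpha> * sqrt N) * \<tau>"
      using central_inner_le[OF _ xi] by (simp add: N)
    also have "\<dots> = q ^ ?k * (N + \<alpha> * sqrt N)"
      by (simp only: \<tau> mult.commute)
    also have "\<dots> \<le> \<epsilon>"
    proof (rule power_nat_ceiling_log_le[OF q eps])
      show "0 < N + \<alpha> * sqrt N"
        using sqrt_N \<open>0 < \<alpha>\<close> by (simp add: N add_pos_pos)
    qed
    finally show ?thesis .
  qed

  show ?thesis
    using step gap unfolding N_def by blast
qed

end
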